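(* There exists a self-dual geometric polycyclic $(21_4)$ configuration with threefold rotational symmetry (i.e. whose rotational symmetry group is of order 3).
   Context: A combinatorial $(n_k)$ configuration consists of $n$ points and $n$ lines (lines being sets of points) such that each point is incident with exactly $k$ lines and each line contains exactly $k$ points. It is geometric if the points are distinct points of the Euclidean plane and the lines are distinct straight lines, with the incidences of the configuration holding. A geometric configuration is polycyclic if the orbits of its points and of its lines under its maximal group of rotational symmetries (its symmetry classes) all have the same number of elements. A configuration is self-dual if it is combinatorially isomorphic to its dual (the configuration obtained by interchanging the roles of points and lines). *)

theory Defs
  imports "HOL-Analysis.Analysis"
begin

record ('p, 'l) incidence_structure =
  points :: "'p set"
  lines :: "'l set"
  incident :: "'p \<Rightarrow> 'l \<Rightarrow> bool"

definition incidence_isomorphic ::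
    "('p, 'l) incidence_structure \<Rightarrow> ('q, 'm) incidence_structure \<Rightarrow> bool" where
  "incidence_isomorphic C D \<longleftrightarrow>
     (\<exists>f g. bij_betw f (points C) (points D) \<and> bij_betw g (lines C) (lines D) \<and>
        (\<forall>p\<in>points C. \<forall>l\<in>lines C. incident C p l \<longleftrightarrow> incident D (f p) (g l)))"

definition dual :: "('p, 'l) incidence_structure \<Rightarrow> ('l, 'p) incidence_structure" where
  "dual C = \<lparr>points = lines C, lines = points C, incident = (\<lambda>l p. incident C p l)\<rparr>"

definition self_dual :: "('p, 'l) incidence_structure \<Rightarrow> bool" where
  "self_dual C \<longleftrightarrow> incidence_isomorphic C (dual C)"

text \<open>
  The injectivity clause says that a line is determined by its point set, so that combinatorial
  lines may be regarded as sets of points.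
\<close>

definition configuration :: "nat \<Rightarrow> nat \<Rightarrow> ('p, 'l) incidence_structure \<Rightarrow> bool" where
  "configuration n k C \<longleftrightarrow>
     finite (points C) \<and> card (points C) = n \<and>
     finite (lines C) \<and> card (lines C) = n \<and>
     inj_on (\<lambda>l. {p \<in> points C. incident C p l}) (lines C) \<and>
     (\<forall>p\<in>points C. card {l \<in> lines C. incident C p l} = k) \<and>
     (\<forall>l\<in>lines C. card {p \<in> points C. incident C p l} = k)"

text \<open>
  The Euclidean plane is the type \<^typ>\<open>complex\<close> with its Euclidean structure. In a geometric
  configuration incidence is membership, so points and lines of the configuration have no
  incidences in the plane beyond the combinatorial ones.
\<close>

definition straight_line :: "complex set \<Rightarrow> bool" where
  "straight_line l \<longleftrightarrow> affine l \<and> aff_dim l = 1"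

definition plane_structure ::
    "complex set \<Rightarrow> complex set set \<Rightarrow> (complex, complex set) incidence_structure" where
  "plane_structure P L = \<lparr>points = P, lines = L, incident = (\<in>)\<rparr>"

definition geometric_configuration ::
    "nat \<Rightarrow> nat \<Rightarrow> complex set \<Rightarrow> complex set set \<Rightarrow> bool" where
  "geometric_configuration n k P L \<longleftrightarrow>
     (\<forall>l\<in>L. straight_line l) \<and> configuration n k (plane_structure P L)"

definition rotation :: "complex \<Rightarrow> real \<Rightarrow> complex \<Rightarrow> complex" where
  "rotation c t z = c + cis t * (z - c)"

text \<open>
  The centre of a rotation is not prescribed, and the identity counts as a rotation. For a finite
  nonempty \<open>P\<close> every rotation that preserves \<open>P\<close> fixes the centroid of \<open>P\<close>, and the set below is
  a group under composition; it is then the largest group of rotational symmetries.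
\<close>

definition rotational_symmetries ::
    "complex set \<Rightarrow> complex set set \<Rightarrow> (complex \<Rightarrow> complex) set" where
  "rotational_symmetries P L =
     {f. (\<exists>c t. f = rotation c t) \<and> f ` P = P \<and> (`) f ` L = L}"

definition point_orbit :: "complex set \<Rightarrow> complex set set \<Rightarrow> complex \<Rightarrow> complex set" where
  "point_orbit P L p = (\<lambda>f. f p) ` rotational_symmetries P L"

definition line_orbit :: "complex set \<Rightarrow> complex set set \<Rightarrow> complex set \<Rightarrow> complex set set" where
  "line_orbit P L l = (\<lambda>f. f ` l) ` rotational_symmetries P L"

definition polycyclic :: "complex set \<Rightarrow> complex set set \<Rightarrow> bool" where
  "polycyclic P L \<longleftrightarrow>
     (\<exists>m. (\<forall>p\<in>P. card (point_orbit P L p) = m) \<and> (\<forall>l\<in>L. card (line_orbit P L l) = m))"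

lemma rotational_symmetry_about_centroid:
  assumes "finite P" "P \<noteq> {}" "f \<in> rotational_symmetries P L"
  shows "\<exists>t. f = rotation ((\<Sum>p\<in>P. p) / of_nat (card P)) t"
proof -
  define N where "N = (of_nat (card P) :: complex)"
  define m where "m = (\<Sum>p\<in>P. p) / N"
  have N: "N \<noteq> 0" using assms(1,2) by (simp add: N_def)
  from assms(3) obtain c t where f: "f = rotation c t" and fP: "f ` P = P"
    by (auto simp: rotational_symmetries_def)
  have "inj_on f P" unfolding f rotation_def by (auto simp: inj_on_def)
  then have "(\<Sum>p\<in>f ` P. p) = (\<Sum>p\<in>P. f p)" by (simp add: sum.reindex)
  then have "(\<Sum>p\<in>P. p) = (\<Sum>p\<in>P. c + cis t * (p - c))"
    unfolding fP unfolding f rotation_def .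
  also have "\<dots> = N * c + cis t * ((\<Sum>p\<in>P. p) - N * c)"
    by (simp add: sum.distrib sum_subtractf flip: sum_distrib_left) (simp add: N_def)
  finally have "N * m = N * (c + cis t * (m - c))"
    using N by (simp add: m_def algebra_simps)
  then have "m = c + cis t * (m - c)" using N by (metis mult_left_cancel)
  then have m: "c = m - cis t * (m - c)" by (metis add_diff_cancel_right')
  have "f z = rotation m t z" for z
  proof -
    have "f z = c + cis t * (z - c)" by (simp add: f rotation_def)
    also have "\<dots> = (m - cis t * (m - c)) + cis t * (z - c)" using m by simp
    also have "\<dots> = rotation m t z" by (simp add: rotation_def algebra_simps)
    finally show ?thesis .
  qed
  then show ?thesis unfolding m_def N_def by blast
qed

lemma rotational_symmetries_id: "id \<in> rotational_symmetries P L"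
proof -
  have "id = rotation 0 0" by (auto simp: rotation_def fun_eq_iff)
  then show ?thesis by (auto simp: rotational_symmetries_def image_def)
qed

lemma rotational_symmetries_comp:
  assumes "finite P" "P \<noteq> {}" "f \<in> rotational_symmetries P L" "g \<in> rotational_symmetries P L"
  shows "f \<circ> g \<in> rotational_symmetries P L"
proof -
  define m where "m = (\<Sum>p\<in>P. p) / of_nat (card P)"
  obtain s t where st: "f = rotation m s" "g = rotation m t"
    using assms rotational_symmetry_about_centroid unfolding m_def by metis
  have "f \<circ> g = rotation m (s + t)"
    by (auto simp: st rotation_def fun_eq_iff mult.assoc simp flip: cis_mult)
  moreover have "(f \<circ> g) ` P = P" using assms by (simp add: rotational_symmetries_def flip: image_image)
  moreover have "(`) (f \<circ> g) ` L = (`) f ` (`) g ` L" by (auto simp: image_comp o_def)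
  ultimately show ?thesis using assms unfolding rotational_symmetries_def by auto
qed

lemma rotational_symmetries_inv:
  assumes "f \<in> rotational_symmetries P L"
  shows "\<exists>g\<in>rotational_symmetries P L. g \<circ> f = id \<and> f \<circ> g = id"
proof -
  obtain c t where f: "f = rotation c t" and inv: "f ` P = P" "(`) f ` L = L"
    using assms by (auto simp: rotational_symmetries_def)
  define g where "g = rotation c (- t)"
  have gf: "g (f z) = z" and fg: "f (g z) = z" for z
    by (simp_all add: f g_def rotation_def cis_mult flip: mult.assoc)
  have "g ` f ` P = P" "(`) g ` (`) f ` L = L"
    by (simp_all add: image_image gf)
  then have "g \<in> rotational_symmetries P L"
    unfolding inv by (auto simp: rotational_symmetries_def g_def)
  then show ?thesis using gf fg by (auto simp: fun_eq_iff)
qed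

end

theory Submission
  imports Defs
begin

text \<open>
  The lines are the polars \<open>{z. Re (z * q) = 1}\<close> of the points \<open>q\<close> themselves. Incidence is then a
  symmetric relation on the points, so self-duality is automatic, and so is threefold symmetry of
  the lines once the points are \<open>b\<^sub>i * omega ^ k\<close> with \<open>i < 7\<close>, \<open>k < 3\<close>. The 28 incidences modulo
  rotation become 14 real equations \<open>Re (b\<^sub>i * b\<^sub>j * omega ^ k) = 1\<close> in 14 real unknowns. For a suitable
  labelled 4-regular multigraph on the 7 classes there is a mirror symmetric solution, rational over
  \<open>sqrt 3\<close> and \<open>sqrt A\<close> for a real root \<open>A\<close> of a quintic. All other triples \<open>(i, j, k)\<close> miss the
  value 1 by a wide margin, so approximations exclude further incidences. One of the seven
  orbits has a radius that no other orbit shares, which forces every rotational symmetry to have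
  order dividing 3.
\<close>

section \<open>Polarity in the unit circle, composed with complex conjugation\<close>

text \<open>With \<open>q\<close> in place of \<open>cnj q\<close> the form
  \<open>Re (z * q)\<close> is symmetric, and the incidence of \<open>b i * omega ^ s\<close> with
  the line of \<open>b j * omega ^ t\<close> depends on s + t. The plain polarity would give s -
  t.\<close>

definition polar_line :: "complex \<Rightarrow> complex set" where
  "polar_line q = {z. Re (z * q) = 1}"

lemma mem_polar_line: "z \<in> polar_line q \<longleftrightarrow> Re (z * q) = 1"
  by (simp add: polar_line_def)

lemma straight_line_polar_line:
  assumes "q \<noteq> 0"
  shows "straight_line (polar_line q)"
proof -
  have "polar_line q = {z. cnj q \<bullet> z = 1}"
    by (auto simp: polar_line_def inner_complex_def algebra_simps)
  moreover have "cnj q \<noteq> 0" using assms by simp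
  ultimately show ?thesis
    unfolding straight_line_def by (simp add: affine_hyperplane)
qed

text \<open>The product \<open>z * q\<close> is unchanged when \<open>z\<close> is multiplied by
  \<open>s\<close> and \<open>q\<close> divided by \<open>s\<close>.\<close>

lemma image_polar_line:
  assumes "s \<noteq> 0"
  shows "(*) s ` polar_line q = polar_line (q / s)"
proof -
  have "z \<in> (*) s ` polar_line q" if "z \<in> polar_line (q / s)" for z
  proof (rule image_eqI)
    show "z = s * (z / s)" using assms by simp
    have "z / s * q = z * (q / s)" by simp
    then show "z / s \<in> polar_line q" using that unfolding polar_line_def mem_Collect_eq by metis
  qed
  moreover have "s * z \<in> polar_line (q / s)" if "z \<in> polar_line q" for z
  proof -
    have "s * z * (q / s) = z * q" using assms by simp
    then show ?thesis using that unfolding polar_line_def mem_Collect_eq by metis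
  qed
  ultimately show ?thesis by blast
qed

text \<open>Points and their polars are both recovered from the neighbour sets \<open>nb x\<close>.
  Injectivity of \<open>nb\<close> therefore makes the points distinct, the lines distinct, and each
  line determined by its points.\<close>

lemma polar_configuration:
  fixes pt :: "nat \<Rightarrow> complex"
  assumes inc: "\<And>x y. x < n \<Longrightarrow> y < n \<Longrightarrow> Re (pt x * pt y) = 1 \<longleftrightarrow> y \<in> nb x"
    and card: "\<And>x. x < n \<Longrightarrow> card (nb x) = k" "0 < k"
    and sub: "\<And>x. x < n \<Longrightarrow> nb x \<subseteq> {..<n}"
    and inj: "inj_on nb {..<n}"
  defines "P \<equiv> pt ` {..<n}"
  shows "inj_on pt {..<n}" and "0 \<notin> P" and "inj_on polar_line P"
    and "geometric_configuration n k P (polar_line ` P)"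
    and "self_dual (plane_structure P (polar_line ` P))"
proof -
  have eqI: "x = y" if "x < n" "y < n" "\<And>z. z < n \<Longrightarrow> Re (pt x * pt z) = 1 \<longleftrightarrow> Re (pt y * pt z) = 1" for x y
  proof -
    have "nb x = nb y" using that inc sub by blast
    then show ?thesis using inj that by (auto dest: inj_onD)
  qed
  show ipt: "inj_on pt {..<n}"
    by (rule inj_onI) (auto intro: eqI)
  have nz: "pt x \<noteq> 0" if x: "x < n" for x
  proof
    assume 0: "pt x = 0"
    obtain y where "y \<in> nb x" using card(1)[OF x] card(2) by fastforce
    then show False using inc[OF x] sub[OF x] 0 by force
  qed
  then show "0 \<notin> P" by (auto simp: P_def)
  have pl: "{p \<in> P. p \<in> polar_line (pt x)} = pt ` nb x" if "x < n" for x
    using inc[OF that] sub[OF that] by (auto simp: P_def polar_line_def mult.commute)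
  have pt_nb: "x = y" if "x < n" "y < n" "pt ` nb x = pt ` nb y" for x y
  proof -
    have "nb x = nb y" using that(3) inj_on_image_eq_iff[OF ipt sub sub] that by simp
    then show ?thesis using inj that by (auto dest: inj_onD)
  qed
  show ipl: "inj_on polar_line P"
  proof (rule inj_onI)
    fix p q assume "p \<in> P" "q \<in> P" and eq: "polar_line p = polar_line q"
    then obtain x y where xy: "x < n" "p = pt x" "y < n" "q = pt y" by (auto simp: P_def)
    then have "pt ` nb x = pt ` nb y" using pl[of x] pl[of y] eq by simp
    then show "p = q" using pt_nb xy by blast
  qed
  have cardP: "card P = n" using ipt by (simp add: P_def card_image)
  have card_nb: "card (pt ` nb x) = k" if "x < n" for x
    using card_image[OF inj_on_subset[OF ipt sub[OF that]]] card(1)[OF that] by simp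
  show "geometric_configuration n k P (polar_line ` P)"
    unfolding geometric_configuration_def configuration_def plane_structure_def
  proof (simp, intro conjI ballI)
    show "straight_line (polar_line p)" if "p \<in> P" for p
      using that nz by (auto simp: P_def intro: straight_line_polar_line)
    show "finite P" by (simp add: P_def)
    then show "finite (polar_line ` P)" by simp
    show "card P = n" by (rule cardP)
    then show "card (polar_line ` P) = n" using ipl by (simp add: card_image)
    show "inj_on (\<lambda>l. {p \<in> P. p \<in> l}) (polar_line ` P)"
    proof (rule inj_onI)
      fix l m assume "l \<in> polar_line ` P" "m \<in> polar_line ` P"
        and eq: "{p \<in> P. p \<in> l} = {p \<in> P. p \<in> m}"
      then obtain x y where xy: "x < n" "l = polar_line (pt x)" "y < n" "m = polar_line (pt y)"
        by (auto simp: P_def)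
      then show "l = m" using pt_nb[of x y] pl[of x] pl[of y] eq by simp
    qed
    show "card {l \<in> polar_line ` P. p \<in> l} = k" if p: "p \<in> P" for p
    proof -
      obtain x where x: "x < n" "p = pt x" using p by (auto simp: P_def)
      \<comment> \<open>By symmetry of the form, the lines through \<open>p\<close> are the polars
        of the points on the polar of \<open>p\<close>, so one count serves points and
        lines.\<close>
      have "{l \<in> polar_line ` P. p \<in> l} = polar_line ` {q \<in> P. q \<in> polar_line p}"
        by (auto simp: polar_line_def mult.commute)
      also have "\<dots> = polar_line ` pt ` nb x" using pl[OF x(1)] x(2) by simp
      also have "card \<dots> = card (pt ` nb x)"
        using sub[OF x(1)] by (intro card_image inj_on_subset[OF ipl]) (auto simp: P_def)
      finally show ?thesis using card_nb[OF x(1)] by simp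
    qed
    show "card {q \<in> P. q \<in> polar_line p} = k" if "p \<in> P" for p
      using that pl card_nb by (auto simp: P_def)
  qed
  show "self_dual (plane_structure P (polar_line ` P))"
    unfolding self_dual_def incidence_isomorphic_def
  proof (intro exI conjI)
    \<comment> \<open>The duality sends each point to its polar and each line back to its
      pole.\<close>
    show "bij_betw polar_line (points (plane_structure P (polar_line ` P)))
        (points (dual (plane_structure P (polar_line ` P))))"
      using ipl by (simp add: dual_def plane_structure_def bij_betw_def)
    show "bij_betw (inv_into P polar_line) (lines (plane_structure P (polar_line ` P)))
        (lines (dual (plane_structure P (polar_line ` P))))"
      using ipl by (simp add: dual_def plane_structure_def bij_betw_inv_into bij_betw_imageI)
    have "p \<in> polar_line q \<longleftrightarrow> inv_into P polar_line (polar_line q) \<in> polar_line p"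
      if "q \<in> P" for p q
      using ipl that by (auto simp: mem_polar_line mult.commute)
    then show "\<forall>p\<in>points (plane_structure P (polar_line ` P)).
        \<forall>l\<in>lines (plane_structure P (polar_line ` P)).
          incident (plane_structure P (polar_line ` P)) p l \<longleftrightarrow>
          incident (dual (plane_structure P (polar_line ` P))) (polar_line p) (inv_into P polar_line l)"
      by (simp add: dual_def plane_structure_def)
  qed
qed

section \<open>Threefold symmetry\<close>

definition omega :: complex where
  "omega = cis (2 * pi / 3)"

lemma omega_eq: "omega = Complex (-1/2) (sqrt 3 / 2)"
  by (simp add: omega_def cis.ctr cos_120 sin_120)

lemma omega_squared: "omega ^ 2 = Complex (-1/2) (- sqrt 3 / 2)"
  by (simp add: omega_eq power2_eq_square complex_eq_iff)

lemma omega_cubed: "omega ^ 3 = 1"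
  by (simp add: omega_def Complex.DeMoivre)

lemma norm_omega: "cmod omega = 1"
  by (simp add: omega_def)

lemma omega_power_mod: "omega ^ (m mod 3) = omega ^ m"
proof -
  have "omega ^ m = omega ^ (3 * (m div 3) + m mod 3)" by simp
  also have "\<dots> = omega ^ (m mod 3)" by (simp only: power_add power_mult omega_cubed) simp
  finally show ?thesis by simp
qed

lemma inj_omega_power: "inj_on (\<lambda>k. omega ^ k) {..<3}"
proof -
  have "sqrt 3 \<noteq> - sqrt 3" using real_sqrt_gt_zero[of 3] by linarith
  then show ?thesis
    by (auto simp: inj_on_def less_Suc_eq numeral_3_eq_3 omega_squared[unfolded numeral_2_eq_2]
        omega_eq complex_eq_iff)
qed

text \<open>Invariance under \<open>omega\<close> puts the centroid at 0, so a rotational symmetry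
  is multiplication by a unimodular number. It preserves moduli, hence moves \<open>p0\<close> to
  some \<open>omega ^ k * p0\<close>, which determines it. Since no point is 0 and
  \<open>polar_line\<close> is injective on \<open>P\<close>, all orbits have three
  elements.\<close>

lemma rotational_symmetries_order_3:
  assumes fin: "finite P" and nz: "0 \<notin> P"
    and inv: "\<And>p. p \<in> P \<Longrightarrow> omega * p \<in> P"
    and inj: "inj_on polar_line P"
    and p0: "p0 \<in> P" "\<And>p. p \<in> P \<Longrightarrow> cmod p = cmod p0 \<Longrightarrow> \<exists>k<3. p = omega ^ k * p0"
  defines "L \<equiv> polar_line ` P"
  shows "rotational_symmetries P L = (\<lambda>k. (*) (omega ^ k)) ` {..<3}" (is "_ = ?R")
    and "card (rotational_symmetries P L) = 3"
    and "polycyclic P L"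
proof -
  have invk: "omega ^ k * p \<in> P" if "p \<in> P" for k p
    using that by (induction k) (auto simp: mult.assoc intro: inv)
  have nzk: "omega ^ k \<noteq> 0" for k by (simp add: omega_def)
  have im: "(*) (omega ^ k) ` P = P" for k
    using invk nzk by (intro card_subset_eq fin card_image) (auto simp: inj_on_def)
  have "(\<Sum>p\<in>P. p) = (\<Sum>p\<in>(*) omega ` P. p)" using im[of 1] by simp
  also have "\<dots> = omega * (\<Sum>p\<in>P. p)"
    using nzk[of 1] by (subst sum.reindex) (auto simp: inj_on_def sum_distrib_left)
  finally have "(1 - omega) * (\<Sum>p\<in>P. p) = 0" by (simp add: algebra_simps)
  moreover have "omega \<noteq> 1" by (simp add: omega_eq complex_eq_iff)
  ultimately have sum0: "(\<Sum>p\<in>P. p) = 0" by simp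
  have div: "p / omega ^ k \<in> P" if "p \<in> P" for p k
  proof -
    have "p \<in> (*) (omega ^ k) ` P" using im that by simp
    then show ?thesis using nzk by auto
  qed
  show R: "rotational_symmetries P L = ?R"
  proof (intro equalityI subsetI)
    fix f assume f: "f \<in> rotational_symmetries P L"
    then obtain t where t: "f = rotation 0 t"
      using rotational_symmetry_about_centroid[OF fin _ f] p0(1) sum0 by auto
    have "f p0 \<in> P" using f p0(1) by (auto simp: rotational_symmetries_def)
    moreover have "cmod (f p0) = cmod p0" by (simp add: t rotation_def norm_mult)
    ultimately obtain k where k: "k < 3" "f p0 = omega ^ k * p0" using p0(2) by blast
    moreover have "p0 \<noteq> 0" using p0(1) nz by auto
    ultimately have "cis t = omega ^ k" by (simp add: t rotation_def)
    then have "f = (*) (omega ^ k)" by (auto simp: t rotation_def)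
    then show "f \<in> ?R" using k(1) by blast
  next
    fix f assume "f \<in> ?R"
    then obtain k where k: "f = (*) (omega ^ k)" by blast
    have "f = rotation 0 (real k * (2 * pi / 3))"
      by (auto simp: k rotation_def omega_def Complex.DeMoivre)
    moreover have "(`) f ` L = L"
    proof -
      have "(`) f ` L = polar_line ` (\<lambda>q. q / omega ^ k) ` P"
        by (simp add: L_def k image_image image_polar_line[OF nzk])
      also have "(\<lambda>q. q / omega ^ k) ` P = P"
        using div nzk by (intro card_subset_eq fin card_image) (auto simp: inj_on_def)
      finally show ?thesis by (simp add: L_def)
    qed
    moreover have "f ` P = P" using im k by simp
    ultimately show "f \<in> rotational_symmetries P L"
      unfolding rotational_symmetries_def by (intro CollectI conjI exI)
  qed
  have "inj_on (\<lambda>k. (*) (omega ^ k)) {..<3}"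
  proof (rule inj_onI)
    fix j k :: nat assume "j \<in> {..<3}" "k \<in> {..<3}" and eq: "(*) (omega ^ j) = (*) (omega ^ k)"
    moreover have "omega ^ j = omega ^ k" using fun_cong[OF eq, of 1] by simp
    ultimately show "j = k" using inj_omega_power by (auto dest: inj_onD)
  qed
  then show "card (rotational_symmetries P L) = 3" by (simp add: R card_image)
  have "card (point_orbit P L p) = 3" if "p \<in> P" for p
  proof -
    have "p \<noteq> 0" using that nz by auto
    then have "inj_on (\<lambda>k. omega ^ k * p) {..<3}" using inj_omega_power by (auto simp: inj_on_def)
    then show ?thesis by (simp add: point_orbit_def R image_image card_image)
  qed
  moreover have "card (line_orbit P L l) = 3" if l: "l \<in> L" for l
  proof -
    obtain q where q: "q \<in> P" "l = polar_line q" using l by (auto simp: L_def)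
    then have "q \<noteq> 0" using nz by auto
    have "inj_on (\<lambda>k. polar_line (q / omega ^ k)) {..<3}"
    proof (rule inj_onI)
      fix j k :: nat assume jk: "j \<in> {..<3}" "k \<in> {..<3}"
        and "polar_line (q / omega ^ j) = polar_line (q / omega ^ k)"
      then have "q / omega ^ j = q / omega ^ k" using inj div[OF q(1)] by (auto dest: inj_onD)
      then have "omega ^ j = omega ^ k" using \<open>q \<noteq> 0\<close> nzk by (simp add: field_simps)
      then show "j = k" using inj_omega_power jk by (auto dest: inj_onD)
    qed
    then show ?thesis
      by (simp add: line_orbit_def R q(2) image_image image_polar_line[OF nzk] card_image)
  qed
  ultimately show "polycyclic P L" unfolding polycyclic_def by blast
qed

section \<open>Coordinates\<close>

text \<open>
  The five unknowns of the mirror symmetric solution; \<open>A = a^2\<close> is found first as a root of the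
  quintic that remains after eliminating the others.
\<close>

lemma coordinates_exist:
  obtains a u w c d :: real where
    "a \<in> {5370/10^4..5372/10^4}" "u \<in> {27576/10^4..27580/10^4}" "w \<in> {4670/10^4..4674/10^4}"
    "c \<in> {6108/10^4..6112/10^4}" "d \<in> {12752/10^4..12756/10^4}"
    "u * w = 1 + a^2" "a * (u + w) = sqrt 3" "c * u - d * a = 1"
    "c * (w - sqrt 3 * a) - d * (a + sqrt 3 * w) = -2" "c^2 + d^2 = 2"
proof -
  \<comment> \<open>A root makes \<open>eA\<close> and \<open>e2\<close> below compatible: squaring
    \<open>eA\<close> and comparing with \<open>e2\<close> leaves a multiple of (2A - 1)
    f(A).\<close>
  define f :: "real \<Rightarrow> real" where
    "f = (\<lambda>A. 32 * A^5 + 96 * A^4 + 120 * A^3 + 44 * A^2 + 6 * A - 9)"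
  have "f (288448/10^6) \<le> 0" "f (288449/10^6) \<ge> 0" by (simp_all add: f_def power_divide)
  moreover have "continuous_on {288448/10^6..288449/10^6} f"
    unfolding f_def by (intro continuous_intros)
  ultimately obtain A where A: "288448/10^6 \<le> A" "A \<le> 288449/10^6" "f A = 0"
    using IVT'[of f "288448/10^6" 0 "288449/10^6"] by auto
  define a where "a = sqrt A"
  define r where "r = sqrt (3::real)"
  \<comment> \<open>Here \<open>e\<close> is (u - w)/(u + w), so \<open>a * (u + w) = sqrt 3\<close>
    is built in. The formula comes from \<open>c^2 + d^2 = 2\<close>, which becomes linear in
    \<open>e\<close> once \<open>e^2\<close> is eliminated by \<open>e2\<close>.\<close>
  define e where "e = (3 - 4*A - 2*A^2 - 4*A^3) / (6*A*(1+A))"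
  define u where "u = r * (1 + e) / (2 * a)"
  define w where "w = r * (1 - e) / (2 * a)"
  \<comment> \<open>Up to scaling and modulo \<open>e2\<close>, this is the determinant of the two
    equations linear in \<open>c\<close> and \<open>d\<close>. The quotients below are Cramer's
    rule.\<close>
  define D where "D = e + 1 + 2 * A"
  define c where "c = (6 * A + 3 - 3 * e) / (2 * a * r * D)"
  define d where "d = (3 + e - 2 * A) / (2 * a * D)"
  have r: "r > 0" "r * r = 3" "173205/10^5 \<le> r" "r \<le> 173206/10^5"
    unfolding r_def
    by (simp, simp, rule real_le_rsqrt, simp add: power_divide, rule real_le_lsqrt, simp_all add: power_divide)
  have a: "a > 0" "a * a = A" "53707/10^5 \<le> a" "a \<le> 53708/10^5"
    unfolding a_def using A
    by (simp, simp, intro real_le_rsqrt, simp add: power_divide, intro real_le_lsqrt, simp_all add: power_divide)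
  have A2: "(288448/10^6)^n \<le> A^n" "A^n \<le> (288449/10^6)^n" for n
    using A by (auto intro!: power_mono)
  have eA: "6*A*(1+A)*e = 3 - 4*A - 2*A^2 - 4*A^3" using A by (simp add: e_def)
  have e: "71025/10^5 \<le> e" "e \<le> 71027/10^5"
    unfolding e_def using A A2[of 2] A2[of 3]
    by (auto simp: pos_le_divide_eq pos_divide_le_eq algebra_simps power2_eq_square power_divide)
  \<comment> \<open>This is the equation \<open>u * w = 1 + a^2\<close> expressed in
    \<open>A\<close> and \<open>e\<close>.\<close>
  have e2: "3 * e^2 = 3 - 4*A - 4*A^2"
  proof -
    have "(6*A*(1+A))^2 * (3 * e^2) = 3 * (6*A*(1+A)*e)^2" by (simp add: power_mult_distrib)
    also have "\<dots> = (6*A*(1+A))^2 * (3 - 4*A - 4*A^2) + 3 * (2*A - 1) * f A"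
      unfolding eA f_def by algebra
    finally show ?thesis using A by simp
  qed
  have D: "D > 0" "228714/10^5 \<le> D" "D \<le> 228717/10^5" using A e by (auto simp: D_def)
  have ua: "2 * (a * u) = r * (1 + e)" "2 * (a * w) = r * (1 - e)"
    using a by (simp_all add: u_def w_def)
  have cd: "2 * D * (a * (r * c)) = 6 * A + 3 - 3 * e" "2 * D * (a * d) = 3 + e - 2 * A"
    using a r D by (simp_all add: c_def d_def)
  \<comment> \<open>Interval division for positive quantities: bounds on \<open>y\<close> and on the
    product \<open>z\<close> confine the factor \<open>x\<close>, checked by cross-multiplying the
    endpoints.\<close>
  have quot: "x \<in> {l..h}" if "y * x = z" "y1 \<le> y" "y \<le> y2" "z1 \<le> z" "z \<le> z2"
      "0 < y1" "0 < l" "0 < h" "l * y2 \<le> z1" "z2 \<le> h * y1" for x y z l h y1 y2 z1 z2 :: real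
  proof -
    have "l * y \<le> l * y2" "h * y1 \<le> h * y" using that by auto
    then have "y * l \<le> y * x" "y * x \<le> y * h" using that(1,4,5,9,10) by (simp_all add: mult.commute)
    moreover have "0 < y" using that(2,6) by simp
    ultimately show ?thesis by simp
  qed
  have mul: "l1 * l2 \<le> x * y" "x * y \<le> h1 * h2"
    if "l1 \<le> x" "x \<le> h1" "l2 \<le> y" "y \<le> h2" "0 \<le> l1" "0 \<le> l2" for x y l1 l2 h1 h2 :: real
    using that by (auto intro!: mult_mono)
  note re = mul[of "173205/10^5" r "173206/10^5" "171025/10^5" "1 + e" "171027/10^5"]
    mul[of "173205/10^5" r "173206/10^5" "28973/10^5" "1 - e" "28975/10^5"]
  note Da = mul[of "228714/10^5" D "228717/10^5" "53707/10^5" a "53708/10^5"]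
  note Dar = mul[of "228714/10^5*(53707/10^5)" "D * a" "228717/10^5*(53708/10^5)" "173205/10^5" r "173206/10^5"]
  have u: "u \<in> {27576/10^4..27580/10^4}"
    by (rule quot[OF ua(1)[folded mult.assoc], of "2*(53707/10^5)" "2*(53708/10^5)"
        "173205/10^5*(171025/10^5)" "173206/10^5*(171027/10^5)"]) (use a r e re in auto)
  have w: "w \<in> {4670/10^4..4674/10^4}"
    by (rule quot[OF ua(2)[folded mult.assoc], of "2*(53707/10^5)" "2*(53708/10^5)"
        "173205/10^5*(28973/10^5)" "173206/10^5*(28975/10^5)"]) (use a r e re in auto)
  have c: "c \<in> {6108/10^4..6112/10^4}"
    by (rule quot[of "D * a * r" _ "(6 * A + 3 - 3 * e) / 2"  "228714/10^5*(53707/10^5)*(173205/10^5)"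
        "228717/10^5*(53708/10^5)*(173206/10^5)" "129993/10^5" "129998/10^5"])
       (use a r e re A D cd Da Dar in \<open>auto simp: algebra_simps\<close>)
  have d: "d \<in> {12752/10^4..12756/10^4}"
    by (rule quot[of "D * a" _ "(3 + e - 2 * A) / 2"  "228714/10^5*(53707/10^5)"
        "228717/10^5*(53708/10^5)" "156667/10^5" "156670/10^5"])
       (use a r e re A D cd Da in \<open>auto simp: algebra_simps\<close>)
  show thesis
  proof (rule that)
    show "a \<in> {5370/10^4..5372/10^4}" using a by auto
    show "u \<in> {27576/10^4..27580/10^4}" "w \<in> {4670/10^4..4674/10^4}"
      "c \<in> {6108/10^4..6112/10^4}" "d \<in> {12752/10^4..12756/10^4}" by fact+
    have "4 * A * (u * w) = 2 * (a * u) * (2 * (a * w))" by (simp flip: a(2))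
    also have "\<dots> = r * r * (1 - e^2)" unfolding ua by algebra
    also have "\<dots> = (3 - 4*A - 4*A^2) + (4*A + 4*A^2) - 3 * e^2" unfolding r(2) by algebra
    also have "\<dots> = 4 * A * (1 + a^2)" unfolding e2 a(2)[symmetric] by algebra
    finally show "u * w = 1 + a^2" using A by simp
    show "a * (u + w) = sqrt 3" using ua unfolding r_def[symmetric] by (simp add: algebra_simps)
    have "4 * D * A * r * (c * u - d * a) =
        2 * D * (a * (r * c)) * (2 * (a * u)) - 2 * r * A * (2 * D * (a * d))"
      unfolding a(2)[symmetric] by algebra
    also have "\<dots> = r * (4 * A * (e + 1 + 2*A) + (3 - 4*A - 4*A^2) - 3 * e^2)"
      unfolding ua cd by algebra
    also have "\<dots> = 4 * D * A * r * 1"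
      unfolding e2 D_def by algebra
    finally have "4 * D * A * r * (c * u - d * a) = 4 * D * A * r * 1" .
    then show "c * u - d * a = 1" using A D r by simp
    have "4 * D * A * r * (c * (w - r * a) - d * (a + r * w)) =
        2 * D * (a * (r * c)) * (2 * (a * w)) - 2 * r * A * (2 * D * (a * (r * c)))
        - 2 * r * A * (2 * D * (a * d)) - r * r * (2 * D * (a * d)) * (2 * (a * w))"
      unfolding a(2)[symmetric] by algebra
    also have "\<dots> = r * (2 * (3 * e^2) - 2 * (3 - 4*A - 4*A^2) - 8 * A * (e + 1 + 2*A))"
      unfolding ua cd r(2) by algebra
    also have "\<dots> = 4 * D * A * r * (- 2)"
      unfolding e2 D_def by algebra
    finally have "4 * D * A * r * (c * (w - r * a) - d * (a + r * w)) = 4 * D * A * r * (- 2)" .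
    moreover have "4 * D * A * r \<noteq> 0" using A D r by simp
    ultimately show "c * (w - sqrt 3 * a) - d * (a + sqrt 3 * w) = -2"
      unfolding r_def[symmetric] by (metis mult_left_cancel)
    have "4 * (r * r) * A * D^2 * c^2 = (2 * D * (a * (r * c)))^2"
      "4 * A * D^2 * d^2 = (2 * D * (a * d))^2"
      unfolding a(2)[symmetric] by algebra+
    then have "12 * A * D^2 * (c^2 + d^2) = (6 * A + 3 - 3 * e)^2 + 3 * (3 + e - 2 * A)^2"
      unfolding cd r(2) by (simp add: algebra_simps)
    \<comment> \<open>Both correction terms vanish, the first by \<open>e2\<close> and the second by
      \<open>eA\<close>.\<close>
    also have "\<dots> = 24 * A * (e + 1 + 2*A)^2 + (4 - 8*A) * (3 * e^2 - (3 - 4*A - 4*A^2))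
        - 16 * (6*A*(1+A)*e - (3 - 4*A - 2*A^2 - 4*A^3))"
      by algebra
    also have "\<dots> = 12 * A * D^2 * 2"
      unfolding e2 eA D_def by algebra
    finally have "12 * A * D^2 * (c^2 + d^2) = 12 * A * D^2 * 2" .
    then show "c^2 + d^2 = 2" using A D by simp
  qed
qed

section \<open>Incidence labels and decimal approximations\<close>

text \<open>
  The points \<open>b\<^sub>i * omega ^ s\<close> and \<open>b\<^sub>j * omega ^ t\<close> are incident (each with the polar of the other)
  iff \<open>(s + t) mod 3\<close> occurs in \<open>labels i j\<close>.
\<close>

definition labels :: "nat \<Rightarrow> nat \<Rightarrow> nat list" where
  "labels i j =
    [[[], [0, 2], [0], [0], [], [], []],
     [[0, 2], [], [2], [0], [], [], []],
     [[0], [2], [], [], [1, 2], [], []],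
     [[0], [0], [], [], [], [0], [0]],
     [[], [], [1, 2], [], [], [0], [1]],
     [[], [], [], [0], [0], [], [0, 1]],
     [[], [], [], [0], [1], [0, 1], []]] ! i ! j"

text \<open>The entries are, up to sign, the midpoints of the intervals in
  \<open>coordinates_exist\<close>, except that -18619 approximates \<open>- 1 / a\<close>.\<close>

definition approx_base :: "nat \<Rightarrow> int \<times> int" where
  "approx_base i =
    [(27578, 5371), (4672, 5371), (6110, 12754), (0, -18619),
     (-6110, 12754), (-27578, 5371), (-4672, 5371)] ! i"

definition approx_omega :: "nat \<Rightarrow> int \<times> int" where
  "approx_omega k = [(10000, 0), (-5000, 8660), (-5000, -8660)] ! k"

text \<open>Decimal approximations are integers in units of \<open>10 ^ (-4)\<close>, so that they can be evaluated.\<close>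

definition scaled :: "int \<times> int \<Rightarrow> complex" where
  "scaled z = Complex (of_int (fst z) / 10^4) (of_int (snd z) / 10^4)"

definition scaled_Re_mult :: "int \<times> int \<Rightarrow> int \<times> int \<Rightarrow> int \<times> int \<Rightarrow> int" where
  "scaled_Re_mult x y z =
    (fst x * fst y - snd x * snd y) * fst z - (fst x * snd y + snd x * fst y) * snd z"

lemma Re_mult_scaled: "Re (scaled x * scaled y * scaled z) = of_int (scaled_Re_mult x y z) / 10^12"
  by (simp add: scaled_def scaled_Re_mult_def field_simps)

text \<open>A finite exact integer computation. Three factors in units of 10^-4 make 10^12 stand for
  1, so the excluded values miss 1 by more than 1/10.\<close>

lemma not_labels:
  assumes "i < 7" "j < 7" "k < 3" "k \<notin> set (labels i j)"
  shows "\<bar>scaled_Re_mult (approx_base i) (approx_base j) (approx_omega k) - 10^12\<bar> > 10^11"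
proof -
  have "list_all (\<lambda>i. list_all (\<lambda>j. list_all (\<lambda>k. k \<notin> set (labels i j) \<longrightarrow>
      \<bar>scaled_Re_mult (approx_base i) (approx_base j) (approx_omega k) - 10^12\<bar> > 10^11)
      [0..<3]) [0..<7]) [0..<7]"
    by code_simp
  then show ?thesis using assms unfolding list_all_iff set_upt atLeast0LessThan by blast
qed

lemma norm_approx_base_le: "cmod (scaled (approx_base i)) \<le> 3" if "i < 7"
proof -
  have "i \<in> {0,1,2,3,4,5,6}" using that by auto
  then show ?thesis
    by (auto simp: cmod_def scaled_def approx_base_def power_divide intro!: real_le_lsqrt)
qed

text \<open>The orbit of base point 3 is to be the one with a radius of its own. The gap 1/100
  survives the error of 1/1000 in each of the two norms.\<close>

lemma norm_approx_base_3_isolated: "\<bar>cmod (scaled (approx_base i)) - cmod (scaled (approx_base 3))\<bar> > 1/100"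
  if "i < 7" "i \<noteq> 3"
proof -
  have 3: "cmod (scaled (approx_base 3)) = 18619/10^4"
    by (simp add: scaled_def approx_base_def cmod_def)
  have "i \<in> {0, 5} \<or> i \<in> {1, 2, 4, 6}" using that by auto
  then show ?thesis
  proof
    assume "i \<in> {0, 5}"
    then have "19/10 < cmod (scaled (approx_base i))"
      by (intro power2_less_imp_less[of "19/10" "cmod (scaled (approx_base i))"])
         (auto simp: cmod_power2 scaled_def approx_base_def power_divide)
    then show ?thesis unfolding 3 by simp
  next
    assume "i \<in> {1, 2, 4, 6}"
    then have "cmod (scaled (approx_base i)) < 18/10"
      by (intro power2_less_imp_less[of "cmod (scaled (approx_base i))" "18/10"])
         (auto simp: cmod_power2 scaled_def approx_base_def power_divide)
    then show ?thesis unfolding 3 by simp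
  qed
qed

lemma norm_omega_power_approx_le: "cmod (omega ^ k - scaled (approx_omega k)) \<le> 1/1000" if "k < 3"
proof -
  have "173/100 \<le> sqrt (3::real)" "sqrt (3::real) \<le> 1733/1000"
    by (rule real_le_rsqrt, simp add: power_divide, rule real_le_lsqrt, simp_all add: power_divide)
  then have s: "\<bar>sqrt 3 / 2 - 433/500\<bar> \<le> 1/1000" by (intro abs_leI) linarith+
  have "omega ^ 0 - scaled (approx_omega 0) = 0"
    by (simp add: scaled_def approx_omega_def complex_eq_iff)
  moreover have "omega ^ 1 - scaled (approx_omega 1) = Complex 0 (sqrt 3 / 2 - 433/500)"
    by (simp add: omega_eq scaled_def approx_omega_def complex_eq_iff)
  moreover have "omega ^ 2 - scaled (approx_omega 2) = Complex 0 (- (sqrt 3 / 2 - 433/500))"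
    unfolding omega_squared by (simp add: scaled_def approx_omega_def complex_eq_iff)
  moreover have "k = 0 \<or> k = 1 \<or> k = 2" using that by auto
  ultimately show ?thesis
    using s by (elim disjE) (simp_all add: cmod_def abs_minus_commute del: One_nat_def)
qed

text \<open>Replacing the three factors by their approximations one at a time costs at most (4 + 3 +
  9)/1000, well below the gap of 1/10.\<close>

lemma Re_mult_omega_neq_1:
  assumes "cmod (x - scaled x') \<le> 1/1000" "cmod (y - scaled y') \<le> 1/1000"
    "cmod (scaled x') \<le> 3" "cmod (scaled y') \<le> 3" "k < 3"
    "\<bar>scaled_Re_mult x' y' (approx_omega k) - 10^12\<bar> > 10^11"
  shows "Re (x * y * omega ^ k) \<noteq> 1"
proof
  assume 1: "Re (x * y * omega ^ k) = 1"
  let ?x = "scaled x'" and ?y = "scaled y'" and ?o = "scaled (approx_omega k)"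
  have "cmod y \<le> 4" using norm_triangle_sub[of y ?y] assms by simp
  have "cmod ((x - ?x) * y * omega ^ k) \<le> 1/1000 * 4 * 1"
    "cmod (?x * (y - ?y) * omega ^ k) \<le> 3 * (1/1000) * 1"
    "cmod (?x * ?y * (omega ^ k - ?o)) \<le> 3 * 3 * (1/1000)"
    unfolding norm_mult norm_power norm_omega power_one
    using assms \<open>cmod y \<le> 4\<close> norm_omega_power_approx_le[OF assms(5)]
    by (intro mult_mono; simp)+
  then have "cmod ((x - ?x) * y * omega ^ k + ?x * (y - ?y) * omega ^ k + ?x * ?y * (omega ^ k - ?o))
      \<le> 1/1000 * 4 * 1 + 3 * (1/1000) * 1 + 3 * 3 * (1/1000)"
    by (meson add_mono norm_triangle_le)
  moreover have "x * y * omega ^ k - ?x * ?y * ?o =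
      (x - ?x) * y * omega ^ k + ?x * (y - ?y) * omega ^ k + ?x * ?y * (omega ^ k - ?o)"
    by (simp add: algebra_simps)
  ultimately have "cmod (x * y * omega ^ k - ?x * ?y * ?o) \<le> 2/100" by simp
  then have "\<bar>Re (x * y * omega ^ k - ?x * ?y * ?o)\<bar> \<le> 2/100"
    using abs_Re_le_cmod order_trans by blast
  then have "\<bar>1 - of_int (scaled_Re_mult x' y' (approx_omega k)) / 10^12\<bar> \<le> (2/100::real)"
    unfolding minus_complex.sel 1 Re_mult_scaled .
  moreover have "\<bar>of_int (scaled_Re_mult x' y' (approx_omega k)) - 10^12\<bar> > (10^11::real)"
    using assms(6) unfolding of_int_less_iff[symmetric, where 'a = real] by simp
  ultimately show False by (simp add: abs_if field_simps split: if_splits)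
qed

section \<open>Neighbour lists of the 21 points\<close>

text \<open>The number \<open>x < 21\<close> stands for the point \<open>b\<^sub>i * omega ^ s\<close> with \<open>i = x div 3\<close>, \<open>s = x mod 3\<close>.\<close>

definition neighbours :: "nat \<Rightarrow> nat list" where
  "neighbours x = filter (\<lambda>y. (x mod 3 + y mod 3) mod 3 \<in> set (labels (x div 3) (y div 3))) [0..<21]"

lemma length_neighbours:
  assumes "x < 21"
  shows "length (neighbours x) = 4"
proof -
  have "list_all (\<lambda>x. length (neighbours x) = 4) [0..<21]" by code_simp
  then show ?thesis using assms unfolding list_all_iff set_upt atLeast0LessThan by blast
qed

text \<open>The lists are sorted without repetitions, so equal sets mean equal lists, and
  distinctness of the 21 lists is decided by evaluation.\<close>

lemma inj_neighbours: "inj_on (\<lambda>x. set (neighbours x)) {..<21}"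
proof (rule inj_onI)
  fix x y :: nat assume "x \<in> {..<21}" "y \<in> {..<21}" and eq: "set (neighbours x) = set (neighbours y)"
  have "sorted (neighbours z) \<and> distinct (neighbours z)" for z
    unfolding neighbours_def
    by (intro conjI sorted_wrt_filter distinct_filter sorted_upt distinct_upt)
  then have "neighbours x = neighbours y" using eq by (blast intro: sorted_distinct_set_unique)
  moreover have "distinct (map neighbours [0..<21])" by code_simp
  ultimately show "x = y" using \<open>x \<in> {..<21}\<close> \<open>y \<in> {..<21}\<close>
    unfolding distinct_map set_upt atLeast0LessThan by (blast dest: inj_onD)
qed

section \<open>The seven base points and their exact incidences\<close>

lemma labels_commute:
  assumes "i < 7" "j < 7"
  shows "labels i j = labels j i"
proof -
  have "list_all (\<lambda>i. list_all (\<lambda>j. labels i j = labels j i) [0..<7]) [0..<7]" by code_simp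
  then show ?thesis using assms unfolding list_all_iff set_upt atLeast0LessThan by blast
qed

lemma labels_diagonal:
  assumes "i < 7"
  shows "labels i i = []"
proof -
  have "list_all (\<lambda>i. labels i i = []) [0..<7]" by code_simp
  then show ?thesis using assms unfolding list_all_iff set_upt atLeast0LessThan by blast
qed

text \<open>The mirror map sending z to \<open>- cnj z\<close> exchanges 0 with 5, 1 with 6 and 2
  with 4, fixes 3, and negates labels modulo 3. The 14 equations thereby reduce to those solved in
  \<open>coordinates_exist\<close>.\<close>

lemma base_points_exist:
  obtains b :: "nat \<Rightarrow> complex" where
    "\<And>i. i < 7 \<Longrightarrow> cmod (b i - scaled (approx_base i)) \<le> 1/1000"
    "\<And>i j k. i < 7 \<Longrightarrow> j < 7 \<Longrightarrow> k \<in> set (labels i j) \<Longrightarrow> Re (b i * b j * omega ^ k) = 1"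
proof -
  obtain a u w c d :: real where bounds:
    "a \<in> {5370/10^4..5372/10^4}" "u \<in> {27576/10^4..27580/10^4}" "w \<in> {4670/10^4..4674/10^4}"
    "c \<in> {6108/10^4..6112/10^4}" "d \<in> {12752/10^4..12756/10^4}"
    and eqs: "u * w = 1 + a^2" "a * (u + w) = sqrt 3" "c * u - d * a = 1"
    "c * (w - sqrt 3 * a) - d * (a + sqrt 3 * w) = -2" "c^2 + d^2 = 2"
    by (rule coordinates_exist)
  have a: "a > 0" using bounds by simp
  \<comment> \<open>The point \<open>b 3\<close> is chosen so that its polar is the horizontal line
    of height \<open>a\<close>, which carries \<open>b 0\<close>, \<open>b 1\<close>,
    \<open>b 5\<close> and \<open>b 6\<close>.\<close>
  define b where "b = (\<lambda>i. [Complex u a, Complex w a, Complex c d, Complex 0 (- 1 / a),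
      Complex (- c) d, Complex (- u) a, Complex (- w) a] ! i)"
  have b: "b 0 = Complex u a" "b 1 = Complex w a" "b 2 = Complex c d" "b 3 = Complex 0 (- 1 / a)"
    "b 4 = Complex (- c) d" "b 5 = Complex (- u) a" "b 6 = Complex (- w) a"
    by (simp_all add: b_def)
  have near: "cmod (b i - scaled (approx_base i)) \<le> 1/1000" if "i < 7" for i
  proof -
    have "Re (b i - scaled (approx_base i)) \<in> {- 1/2500..1/2500}
        \<and> Im (b i - scaled (approx_base i)) \<in> {- 1/2500..1/2500}"
    proof -
      have "18615/10^4 \<le> 1 / a" "1 / a \<le> 18623/10^4"
        using bounds(1) by (auto simp: field_simps)
      moreover have "i \<in> {0,1,2,3,4,5,6}" using that by auto
      ultimately show ?thesis
        using bounds by (auto simp: b b[simplified] scaled_def approx_base_def field_simps)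
    qed
    then show ?thesis using cmod_le[of "b i - scaled (approx_base i)"] 
      unfolding atLeastAtMost_iff by (elim conjE) linarith
  qed
  have omega1: "Re (z * omega ^ 1) = (- Re z - sqrt 3 * Im z) / 2" for z
    by (simp add: omega_eq)
  have omega2: "Re (z * omega ^ 2) = (- Re z + sqrt 3 * Im z) / 2" for z
    unfolding omega_squared by simp
  \<comment> \<open>Two labels on one pair give two independent linear conditions and so fix the
    whole complex product. This happens in the first three equations; a single label only constrains
    a real part.\<close>
  have prods: "b 0 * b 1 = Complex 1 (sqrt 3)" "b 5 * b 6 = Complex 1 (- sqrt 3)"
    "b 2 * b 4 = Complex (- 2) 0"
    "Re (b 0 * b 2) = 1" "Re (b 4 * b 5) = 1"
    "Re (b 0 * b 3) = 1" "Re (b 1 * b 3) = 1" "Re (b 3 * b 5) = 1" "Re (b 3 * b 6) = 1"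
    using eqs a unfolding b by (simp_all add: complex_eq_iff algebra_simps power2_eq_square)
  have prods': "- Re (b 1 * b 2) + sqrt 3 * Im (b 1 * b 2) = 2"
    "- Re (b 4 * b 6) - sqrt 3 * Im (b 4 * b 6) = 2"
    using eqs(4) unfolding b by (simp_all add: algebra_simps)
  have less: "Re (b i * b j * omega ^ k) = 1" if "i < j" "j < 7" "k \<in> set (labels i j)" for i j k
  proof -
    \<comment> \<open>The labelled edges with \<open>i < j\<close>, one for each of the 14 real
      equations.\<close>
    define E :: "(nat \<times> nat \<times> nat) list" where "E = [(0,1,0), (0,1,2), (0,2,0), (0,3,0), (1,2,2),
      (1,3,0), (2,4,1), (2,4,2), (3,5,0), (3,6,0), (4,5,0), (4,6,1), (5,6,0), (5,6,1)]"
    have "list_all (\<lambda>i. list_all (\<lambda>j. i < j \<longrightarrow>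
        list_all (\<lambda>k. (i, j, k) \<in> set E) (labels i j)) [0..<7]) [0..<7]"
      unfolding E_def by code_simp
    moreover have "i < 7" using that by simp
    ultimately have "(i, j, k) \<in> set E"
      using that unfolding list_all_iff set_upt atLeast0LessThan by blast
    then have "(i, j, k) \<in> {(0,1,0), (0,1,2), (0,2,0), (0,3,0), (1,2,2), (1,3,0), (2,4,1),
        (2,4,2), (3,5,0), (3,6,0), (4,5,0), (4,6,1), (5,6,0), (5,6,1)}"
      unfolding E_def list.set .
    then show ?thesis
      by (elim insertE emptyE; clarify; unfold omega1 omega2 power_0 mult_1_right prods prods'; simp)
  qed
  show thesis
  proof (rule that[OF near])
    fix i j k assume ijk: "i < 7" "j < 7" "k \<in> set (labels i j)"
    consider "i < j" | "i = j" | "j < i" by linarith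
    then show "Re (b i * b j * omega ^ k) = 1"
    proof cases
      case 3
      then show ?thesis using less[of j i k] ijk by (simp only: labels_commute mult.commute[of "b i"])
    qed (use less ijk labels_diagonal in auto)
  qed
qed

text \<open>Exponents of \<open>omega\<close> add modulo 3. Listed labels give incidences by the
  exact equations, and all others are excluded by the numerical gap.\<close>

lemma Re_mult_base_points_iff:
  assumes near: "\<And>i. i < 7 \<Longrightarrow> cmod (b i - scaled (approx_base i)) \<le> 1/1000"
    and inc: "\<And>i j k. i < 7 \<Longrightarrow> j < 7 \<Longrightarrow> k \<in> set (labels i j) \<Longrightarrow> Re (b i * b j * omega ^ k) = 1"
    and "x < 21" "y < 21"
  shows "Re (b (x div 3) * omega ^ (x mod 3) * (b (y div 3) * omega ^ (y mod 3))) = 1 \<longleftrightarrow>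
    y \<in> set (neighbours x)"
proof -
  let ?i = "x div 3" and ?j = "y div 3" and ?k = "(x mod 3 + y mod 3) mod 3"
  have lt: "?i < 7" "?j < 7" "?k < 3" using assms(3,4) by auto
  have "b ?i * omega ^ (x mod 3) * (b ?j * omega ^ (y mod 3)) = b ?i * b ?j * omega ^ ?k"
    by (simp only: omega_power_mod power_add mult_ac)
  moreover have "y \<in> set (neighbours x) \<longleftrightarrow> ?k \<in> set (labels ?i ?j)"
    using assms(4) unfolding neighbours_def set_filter set_upt by simp
  moreover have "Re (b ?i * b ?j * omega ^ ?k) = 1 \<longleftrightarrow> ?k \<in> set (labels ?i ?j)"
    using inc Re_mult_omega_neq_1[OF near near norm_approx_base_le norm_approx_base_le] not_labels lt by metis
  ultimately show ?thesis by (simp only:)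
qed

theorem theorem1:
  "\<exists>P L. geometric_configuration 21 4 P L \<and>
         polycyclic P L \<and>
         card (rotational_symmetries P L) = 3 \<and>
         self_dual (plane_structure P L)"
proof -
  obtain b where near: "\<And>i. i < 7 \<Longrightarrow> cmod (b i - scaled (approx_base i)) \<le> 1/1000"
    and inc: "\<And>i j k. i < 7 \<Longrightarrow> j < 7 \<Longrightarrow> k \<in> set (labels i j) \<Longrightarrow> Re (b i * b j * omega ^ k) = 1"
    using base_points_exist by blast
  define pt where "pt = (\<lambda>x. b (x div 3) * omega ^ (x mod 3))"
  define P where "P = pt ` {..<21}"
  have iff: "Re (pt x * pt y) = 1 \<longleftrightarrow> y \<in> set (neighbours x)" if "x < 21" "y < 21" for x y
    unfolding pt_def by (rule Re_mult_base_points_iff[OF near inc that])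
  have card: "card (set (neighbours x)) = 4" if "x < 21" for x
    using length_neighbours[OF that] distinct_card[of "neighbours x"]
    by (simp only: neighbours_def distinct_filter distinct_upt)
  have sub: "set (neighbours x) \<subseteq> {..<21}" for x
    unfolding neighbours_def set_filter set_upt by auto
  note conf = polar_configuration[OF iff card zero_less_numeral sub inj_neighbours, folded P_def]
  have norm_ne: "cmod (b i) \<noteq> cmod (b 3)" if "i < 7" "i \<noteq> 3" for i
    using norm_approx_base_3_isolated[OF that] near[of i] near[of 3] that(1)
      norm_triangle_ineq3[of "b i" "scaled (approx_base i)"]
      norm_triangle_ineq3[of "b 3" "scaled (approx_base 3)"] by linarith
  have "omega * p \<in> P" if p: "p \<in> P" for p
  proof -
    obtain x where x: "x < 21" "p = pt x" using p unfolding P_def by blast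
    \<comment> \<open>The cyclic successor of \<open>x\<close> within its block of three, which is
      the index of \<open>omega * p\<close>.\<close>
    define y where "y = 3 * (x div 3) + (x mod 3 + 1) mod 3"
    have "y < 21" "y div 3 = x div 3" "y mod 3 = (x mod 3 + 1) mod 3"
    proof -
      have "x div 3 \<le> 6" "(x mod 3 + 1) mod 3 < 3" using x(1) by auto
      then show "y < 21" "y div 3 = x div 3" "y mod 3 = (x mod 3 + 1) mod 3"
        unfolding y_def by (linarith, linarith, simp)
    qed
    then have "pt y = b (x div 3) * omega ^ ((x mod 3 + 1) mod 3)"
      by (simp only: pt_def)
    also have "\<dots> = omega * p"
      by (simp only: pt_def x(2) omega_power_mod power_add power_one_right mult_ac)
    finally show ?thesis using \<open>y < 21\<close> unfolding P_def by (metis imageI lessThan_iff)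
  qed
  moreover have "b 3 \<in> P"
    \<comment> \<open>The index is 9 = 3 * 3 + 0: class 3 with exponent 0.\<close>
    unfolding P_def by (rule image_eqI[of _ _ 9]) (simp_all add: pt_def)
  moreover have "\<exists>k<3. p = omega ^ k * b 3" if p: "p \<in> P" "cmod p = cmod (b 3)" for p
  proof -
    obtain x where x: "x < 21" "p = pt x" using p unfolding P_def by blast
    have "cmod p = cmod (b (x div 3))" by (simp add: x pt_def norm_mult norm_power norm_omega)
    then have "x div 3 = 3" using norm_ne[of "x div 3"] p(2) x(1) by fastforce
    then show ?thesis by (intro exI[of _ "x mod 3"]) (simp add: x pt_def mult.commute)
  qed
  ultimately have "card (rotational_symmetries P (polar_line ` P)) = 3" "polycyclic P (polar_line ` P)"
    using rotational_symmetries_order_3[of P "b 3"] conf(2,3) by (auto simp: P_def)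
  then show ?thesis using conf(4,5) by blast
qed

end
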